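(* Let $G$ be an abelian group. (1) If $G$ is not a torsion group, then $\Delta^{\ast}(\mathcal{B}_{\pm}(G)) = \mathbb{N}$. (2) If $G$ is a torsion group, then $\Delta^{\ast}(\mathcal{B}_{\pm}(G)) = \bigcup_{G'} \Delta^{\ast}(\mathcal{B}_{\pm}(G'))$, where the union is over all finite subgroups $G'$ of $G$.
   Context: $\mathbb{N}$ is the set of positive integers. For a subset $G_0$ of an abelian group $G$, a sequence over $G_0$ is a finite unordered list $S = g_1\cdots g_\ell$ of elements of $G_0$ (repetitions allowed), forming the free commutative monoid over $G_0$ under concatenation. $S$ is a plus-minus weighted zero-sum sequence if $\sum_i \epsilon_i g_i = 0$ for some $\epsilon_i\in\{+1,-1\}$; $\mathcal{B}_{\pm}(G_0)$ is the monoid of these. For a monoid $H$ with trivial unit group: an atom is a non-identity element not a product of two non-identity elements; $\mathsf{L}_H(a)$ is the set of $k$ such that $a$ is a product of $k$ atoms; for finite $L=\{a_0<\dots<a_k\}$, $\Delta(L)=\{a_i-a_{i-1}\}$; $\Delta(H)=\bigcup_a\Delta(\mathsf{L}_H(a))$; a submonoid $S$ is divisor-closed if every divisor in $H$ of an element of $S$ lies in $S$; $\Delta^{\ast}(H)=\{\min\Delta(S)\colon S \text{ divisor-closed submonoid},\ \Delta(S)\ne\emptyset\}$. *)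

theory Defs
  imports "HOL-Algebra.Algebra" "HOL-Library.Multiset"
begin

text \<open>
  Abelian groups are written multiplicatively, as everywhere in HOL-Algebra:
  the signed sum of the \<open>g\<^sub>i\<close> becomes the product of the powers of \<open>g\<^sub>i\<close> with exponents 1 and -1.
  All monoids below are commutative; the notions of atom, factorization and sets of lengths are
  meant for monoids whose only unit is the identity.
\<close>

definition torsion_group :: "('a, 'b) monoid_scheme \<Rightarrow> bool" where
  "torsion_group G \<longleftrightarrow> (\<forall>x\<in>carrier G. \<exists>n::nat. n > 0 \<and> x [^]\<^bsub>G\<^esub> n = \<one>\<^bsub>G\<^esub>)"


subsection \<open>Plus-minus weighted zero-sum sequences\<close>

text \<open>An unordered sequence is a multiset; the list \<open>gs\<close> is an arbitrary enumeration of its terms,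
  so that different occurrences of the same element may carry different signs.\<close>

definition pm_zero_sum :: "('a, 'b) monoid_scheme \<Rightarrow> 'a multiset \<Rightarrow> bool" where
  "pm_zero_sum G S \<longleftrightarrow>
     (\<exists>gs \<epsilon>. mset gs = S \<and> (\<forall>i<length gs. \<epsilon> i \<in> {1, -1 :: int}) \<and>
        (\<Otimes>\<^bsub>G\<^esub>i\<in>{..<length gs}. (gs ! i) [^]\<^bsub>G\<^esub> \<epsilon> i) = \<one>\<^bsub>G\<^esub>)"

definition B_pm :: "('a, 'b) monoid_scheme \<Rightarrow> 'a set \<Rightarrow> 'a multiset monoid" where
  "B_pm G G\<^sub>0 = \<lparr>carrier = {S. set_mset S \<subseteq> G\<^sub>0 \<and> pm_zero_sum G S}, monoid.mult = (+), one = {#}\<rparr>"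


subsection \<open>Sets of lengths and their distances\<close>

definition atom :: "('a, 'b) monoid_scheme \<Rightarrow> 'a \<Rightarrow> bool" where
  "atom H a \<longleftrightarrow> a \<in> carrier H \<and> a \<noteq> \<one>\<^bsub>H\<^esub> \<and>
     \<not> (\<exists>b\<in>carrier H. \<exists>c\<in>carrier H. b \<noteq> \<one>\<^bsub>H\<^esub> \<and> c \<noteq> \<one>\<^bsub>H\<^esub> \<and> a = b \<otimes>\<^bsub>H\<^esub> c)"

text \<open>The identity is the empty product of atoms, so its set of lengths is \<open>{0}\<close>.\<close>

definition lengths :: "('a, 'b) monoid_scheme \<Rightarrow> 'a \<Rightarrow> nat set" where
  "lengths H a = {k. \<exists>us. length us = k \<and> (\<forall>u\<in>set us. atom H u) \<and> foldr (\<otimes>\<^bsub>H\<^esub>) us \<one>\<^bsub>H\<^esub> = a}"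

definition distances :: "nat set \<Rightarrow> nat set" where
  "distances L = {l - k | k l. k \<in> L \<and> l \<in> L \<and> k < l \<and> L \<inter> {k<..<l} = {}}"

definition Delta :: "('a, 'b) monoid_scheme \<Rightarrow> nat set" where
  "Delta H = (\<Union>a\<in>carrier H. distances (lengths H a))"

definition divisor_closed_submonoid :: "'a set \<Rightarrow> ('a, 'b) monoid_scheme \<Rightarrow> bool" where
  "divisor_closed_submonoid S H \<longleftrightarrow>
     submonoid S H \<and> (\<forall>a\<in>S. \<forall>b\<in>carrier H. b divides\<^bsub>H\<^esub> a \<longrightarrow> b \<in> S)"

definition Delta_star :: "('a, 'b) monoid_scheme \<Rightarrow> nat set" where
  "Delta_star H = {(LEAST d. d \<in> Delta (H\<lparr>carrier := S\<rparr>)) | S.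
     divisor_closed_submonoid S H \<and> Delta (H\<lparr>carrier := S\<rparr>) \<noteq> {}}"

end

theory Submission
  imports Defs
begin

text \<open>
  A divisor-closed submonoid \<open>S\<close> of \<open>B\<^sub>\<plusminus>(A)\<close> contains, with each element, the squares \<open>g\<^sup>2\<close>
  of all its terms, because \<open>M\<^sup>2\<close> is the product of these squares; since every \<open>M\<close> divides \<open>M\<^sup>2\<close>,
  \<open>S\<close> is the whole of \<open>B\<^sub>\<plusminus>(G\<^sub>0)\<close>, where \<open>G\<^sub>0\<close> is the support of \<open>S\<close>. A distance is
  already realised over the finite support of one sequence, and finite subsets of abelian torsion
  groups generate finite subgroups; this gives the second part. If \<open>g\<close> has infinite order and
  \<open>h = g\<^sup>n\<close> with \<open>n \<ge> 2\<close>, the atoms over \<open>{g, h}\<close> are \<open>g\<^sup>2\<close>, \<open>h\<^sup>2\<close> and \<open>U = g\<^sup>nh\<close> (concatenation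
  of terms), with the only relation \<open>U\<^sup>2 = (g\<^sup>2)\<^sup>n(h\<^sup>2)\<close>, so that the only distance is \<open>n - 1\<close>.
\<close>

subsection \<open>Signed products\<close>

text \<open>\<open>signed_prod G M y\<close> says that \<open>y\<close> is the product of the terms
  of \<open>M\<close> for some choice of exponents 1 and -1. The inductive form permits induction on
  the multiset, free of enumerations and sign functions.\<close>

inductive signed_prod :: "('a, 'b) monoid_scheme \<Rightarrow> 'a multiset \<Rightarrow> 'a \<Rightarrow> bool" for G (structure) where
  empty: "signed_prod G {#} \<one>"
| pos: "signed_prod G M y \<Longrightarrow> x \<in> carrier G \<Longrightarrow> signed_prod G (add_mset x M) (y \<otimes> x)"
| neg: "signed_prod G M y \<Longrightarrow> x \<in> carrier G \<Longrightarrow> signed_prod G (add_mset x M) (y \<otimes> inv x)"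

context comm_group
begin

lemma signed_prod_closed:
  assumes "signed_prod G M y"
  shows "y \<in> carrier G"
  using assms by induction auto

lemma signed_prod_union:
  assumes "signed_prod G M y" "signed_prod G N z"
  shows "signed_prod G (M + N) (y \<otimes> z)"
  using assms(1)
proof induction
  case empty
  then show ?case using assms(2) signed_prod_closed by simp
next
  case (pos M y x)
  have "signed_prod G (add_mset x (M + N)) (y \<otimes> z \<otimes> x)"
    using pos by (intro signed_prod.pos)
  moreover have "y \<otimes> z \<otimes> x = y \<otimes> x \<otimes> z"
    using pos signed_prod_closed assms(2) by (simp add: m_ac)
  ultimately show ?case by simp
next
  case (neg M y x)
  have "signed_prod G (add_mset x (M + N)) (y \<otimes> z \<otimes> inv x)"
    using neg by (intro signed_prod.neg)
  moreover have "y \<otimes> z \<otimes> inv x = y \<otimes> inv x \<otimes> z"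
    using neg signed_prod_closed assms(2) by (simp add: m_ac)
  ultimately show ?case by simp
qed

text \<open>The two copies of each term receive opposite signs and cancel.\<close>

lemma signed_prod_double:
  "set_mset M \<subseteq> carrier G \<Longrightarrow> signed_prod G (M + M) \<one>"
proof (induction M)
  case empty
  then show ?case by (simp add: signed_prod.empty)
next
  case (add x M)
  then have "signed_prod G (add_mset x (add_mset x (M + M))) (\<one> \<otimes> x \<otimes> inv x)"
    by (intro signed_prod.intros) auto
  then show ?case using add.prems by simp
qed

lemma signed_prod_replicate:
  assumes "x \<in> carrier G"
  shows "signed_prod G (replicate_mset k x) (x [^] k)"
proof (induction k)
  case 0
  then show ?case by (simp add: signed_prod.empty)
next
  case (Suc k)
  then show ?case using assms signed_prod.pos by fastforce
qed

lemma signed_prod_list: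
  assumes "set gs \<subseteq> carrier G" "\<forall>i<length gs. \<epsilon> i \<in> {1, -1 :: int}"
  shows "signed_prod G (mset gs) (\<Otimes>i\<in>{..<length gs}. (gs ! i) [^] \<epsilon> i)"
  using assms
\<comment> \<open>Splitting off the last entry leaves the indices of the others, and hence their
  signs, unchanged.\<close>
proof (induction gs rule: rev_induct)
  case Nil
  then show ?case by (simp add: signed_prod.empty)
next
  case (snoc x gs)
  let ?p = "\<Otimes>i\<in>{..<length gs}. (gs ! i) [^] \<epsilon> i"
  have IH: "signed_prod G (mset gs) ?p" using snoc by simp
  have x: "x \<in> carrier G" using snoc.prems by simp
  have nth: "\<And>i. i < length gs \<Longrightarrow> gs ! i \<in> carrier G" using snoc.prems by auto
  have "(\<Otimes>i\<in>{..<length (gs @ [x])}. ((gs @ [x]) ! i) [^] \<epsilon> i)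
      = x [^] \<epsilon> (length gs) \<otimes> (\<Otimes>i\<in>{..<length gs}. ((gs @ [x]) ! i) [^] \<epsilon> i)"
    using x nth by (simp add: lessThan_Suc nth_append Pi_def)
  also have "(\<Otimes>i\<in>{..<length gs}. ((gs @ [x]) ! i) [^] \<epsilon> i) = ?p"
    using nth by (intro finprod_cong') (auto simp: nth_append)
  finally have eq: "(\<Otimes>i\<in>{..<length (gs @ [x])}. ((gs @ [x]) ! i) [^] \<epsilon> i)
      = ?p \<otimes> x [^] \<epsilon> (length gs)"
    using x signed_prod_closed[OF IH] by (simp add: m_comm)
  have "\<epsilon> (length gs) = 1 \<or> \<epsilon> (length gs) = -1" using snoc.prems by auto
  then show ?case
    unfolding eq using signed_prod.intros(2,3)[OF IH x] x by (auto simp: int_pow_neg)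
qed

lemma signed_prod_imp_list:
  assumes "signed_prod G M y"
  shows "\<exists>gs \<epsilon>. mset gs = M \<and> (\<forall>i<length gs. \<epsilon> i \<in> {1, -1 :: int}) \<and>
           (\<Otimes>i\<in>{..<length gs}. (gs ! i) [^] \<epsilon> i) = y"
proof -
  \<comment> \<open>The new term goes to the end of the list, and its sign is stored at index
    \<open>length gs\<close>, which no earlier term uses.\<close>
  have ext: "\<exists>gs \<epsilon>. mset gs = add_mset x M \<and> set gs \<subseteq> carrier G \<and>
          (\<forall>i<length gs. \<epsilon> i \<in> {1, -1 :: int}) \<and>
          (\<Otimes>i\<in>{..<length gs}. (gs ! i) [^] \<epsilon> i) = y \<otimes> x [^] e"
    if "mset gs = M" "set gs \<subseteq> carrier G" "\<forall>i<length gs. \<epsilon> i \<in> {1, -1 :: int}"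
      "(\<Otimes>i\<in>{..<length gs}. (gs ! i) [^] \<epsilon> i) = y" "x \<in> carrier G" "e \<in> {1, -1}"
    for gs M \<epsilon> x y and e :: int
  proof -
    let ?\<epsilon> = "\<epsilon>(length gs := e)"
    have nth: "\<And>i. i < length gs \<Longrightarrow> gs ! i \<in> carrier G" using that by auto
    have "(\<Otimes>i\<in>{..<length (gs @ [x])}. ((gs @ [x]) ! i) [^] ?\<epsilon> i)
        = x [^] e \<otimes> (\<Otimes>i\<in>{..<length gs}. ((gs @ [x]) ! i) [^] ?\<epsilon> i)"
      using that nth by (simp add: lessThan_Suc nth_append Pi_def)
    also have "(\<Otimes>i\<in>{..<length gs}. ((gs @ [x]) ! i) [^] ?\<epsilon> i)
        = (\<Otimes>i\<in>{..<length gs}. (gs ! i) [^] \<epsilon> i)"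
      using nth by (intro finprod_cong') (auto simp: nth_append)
    also have "x [^] e \<otimes> \<dots> = y \<otimes> x [^] e"
      using that nth by (auto intro!: m_comm finprod_closed)
    finally show ?thesis
      using that by (intro exI[of _ "gs @ [x]"] exI[of _ ?\<epsilon>]) auto
  qed
  from assms have "\<exists>gs \<epsilon>. mset gs = M \<and> set gs \<subseteq> carrier G \<and>
      (\<forall>i<length gs. \<epsilon> i \<in> {1, -1 :: int}) \<and> (\<Otimes>i\<in>{..<length gs}. (gs ! i) [^] \<epsilon> i) = y"
  proof induction
    case empty
    then show ?case by (intro exI[of _ "[]"]) simp
  next
    case (pos M y x)
    then obtain gs \<epsilon> where "mset gs = M" "set gs \<subseteq> carrier G"
      "\<forall>i<length gs. \<epsilon> i \<in> {1, -1 :: int}" "(\<Otimes>i\<in>{..<length gs}. (gs ! i) [^] \<epsilon> i) = y"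
      by blast
    from ext[OF this pos.hyps(2), of 1] pos.hyps(2) show ?case by simp
  next
    case (neg M y x)
    then obtain gs \<epsilon> where "mset gs = M" "set gs \<subseteq> carrier G"
      "\<forall>i<length gs. \<epsilon> i \<in> {1, -1 :: int}" "(\<Otimes>i\<in>{..<length gs}. (gs ! i) [^] \<epsilon> i) = y"
      by blast
    from ext[OF this neg.hyps(2), of "-1"] neg.hyps(2) show ?case by (simp add: int_pow_neg)
  qed
  then show ?thesis by blast
qed

text \<open>Bridge from the enumerated definition to the inductive one, which all later arguments
  use.\<close>

lemma pm_zero_sum_iff_signed_prod:
  assumes "set_mset M \<subseteq> carrier G"
  shows "pm_zero_sum G M \<longleftrightarrow> signed_prod G M \<one>"
proof
  assume "pm_zero_sum G M"
  then obtain gs \<epsilon> where "mset gs = M" "\<forall>i<length gs. \<epsilon> i \<in> {1, -1 :: int}"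
    "(\<Otimes>i\<in>{..<length gs}. (gs ! i) [^] \<epsilon> i) = \<one>"
    unfolding pm_zero_sum_def by blast
  then show "signed_prod G M \<one>" using signed_prod_list[of gs \<epsilon>] assms by auto
next
  assume "signed_prod G M \<one>"
  then show "pm_zero_sum G M" unfolding pm_zero_sum_def by (rule signed_prod_imp_list)
qed

end


subsection \<open>Divisor-closed submonoids\<close>

lemma B_pm_simps [simp]:
  "carrier (B_pm G A) = {S. set_mset S \<subseteq> A \<and> pm_zero_sum G S}"
  "monoid.mult (B_pm G A) = (+)"
  "one (B_pm G A) = {#}"
  by (simp_all add: B_pm_def)

text \<open>\<open>Delta_star\<close> restricts a monoid by updating its carrier; for these
  submonoids the result is again some \<open>B_pm\<close>.\<close>

lemma B_pm_carrier_update: "B_pm G A\<lparr>carrier := carrier (B_pm G A')\<rparr> = B_pm G A'"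
  by (simp add: B_pm_def)

section \<open>Independence of atoms and lengths from the ambient set\<close>

text \<open>The factors of \<open>u\<close> have their support inside that of \<open>u\<close>, so
  enlarging the ambient set creates no new decomposition.\<close>

lemma B_pm_atom_cong:
  assumes "A \<subseteq> A'" "set_mset u \<subseteq> A"
  shows "atom (B_pm G A) u \<longleftrightarrow> atom (B_pm G A') u"
proof -
  have "set_mset b \<subseteq> A \<and> set_mset c \<subseteq> A \<and> set_mset b \<subseteq> A' \<and> set_mset c \<subseteq> A'"
    if "u = b + c" for b c
    using assms that by auto
  moreover have "set_mset u \<subseteq> A'" using assms by blast
  ultimately show ?thesis
    using assms(2) unfolding atom_def Bex_def B_pm_simps mem_Collect_eq by metis
qed

lemma lengths_B_pm:
  "lengths (B_pm G A) M = {length us | us. (\<forall>u\<in>set us. atom (B_pm G A) u) \<and> sum_list us = M}"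
  unfolding lengths_def by (auto simp: sum_list.eq_foldr)

lemma lengths_B_pm_cong:
  assumes "A \<subseteq> A'" "set_mset M \<subseteq> A"
  shows "lengths (B_pm G A) M = lengths (B_pm G A') M"
proof -
  have "(\<forall>u\<in>set us. atom (B_pm G A) u) \<longleftrightarrow> (\<forall>u\<in>set us. atom (B_pm G A') u)"
    if "sum_list us = M" for us
    using that assms by (intro ball_cong refl B_pm_atom_cong) force+
  then show ?thesis unfolding lengths_B_pm by blast
qed

lemma Delta_B_pm_mono:
  assumes "A \<subseteq> A'"
  shows "Delta (B_pm G A) \<subseteq> Delta (B_pm G A')"
proof
  fix d assume "d \<in> Delta (B_pm G A)"
  then obtain M where "set_mset M \<subseteq> A" "pm_zero_sum G M" "d \<in> distances (lengths (B_pm G A) M)"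
    unfolding Delta_def by auto
  then show "d \<in> Delta (B_pm G A')"
    using assms lengths_B_pm_cong[of A A' M G] unfolding Delta_def by auto
qed

text \<open>A distance occurs in the set of lengths of a single sequence \<open>M\<close>, and that
  set depends only on the finite support of \<open>M\<close>.\<close>

lemma Delta_B_pm_finite_support:
  assumes "d \<in> Delta (B_pm G A)"
  obtains F where "finite F" "F \<subseteq> A" "d \<in> Delta (B_pm G F)"
proof -
  obtain M where "set_mset M \<subseteq> A" "pm_zero_sum G M" "d \<in> distances (lengths (B_pm G A) M)"
    using assms unfolding Delta_def by auto
  then show thesis
    using lengths_B_pm_cong[of "set_mset M" A M G]
    by (intro that[of "set_mset M"]) (auto simp: Delta_def)
qed

section \<open>Classification of the divisor-closed submonoids\<close>

context comm_group
begin

lemma pm_zero_sum_union: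
  assumes "set_mset M \<subseteq> carrier G" "set_mset N \<subseteq> carrier G" "pm_zero_sum G M" "pm_zero_sum G N"
  shows "pm_zero_sum G (M + N)"
  using assms signed_prod_union[of M \<one> N \<one>] by (simp add: pm_zero_sum_iff_signed_prod)

lemma pm_zero_sum_double:
  assumes "set_mset M \<subseteq> carrier G"
  shows "pm_zero_sum G (M + M)"
  using assms signed_prod_double by (simp add: pm_zero_sum_iff_signed_prod)

lemma pm_zero_sum_empty: "pm_zero_sum G {#}"
  using pm_zero_sum_double[of "{#}"] by simp

lemma divisor_closed_submonoid_B_pm:
  assumes "A' \<subseteq> A" "A \<subseteq> carrier G"
  shows "divisor_closed_submonoid (carrier (B_pm G A')) (B_pm G A)"
  unfolding divisor_closed_submonoid_def submonoid_def
  using assms by (auto simp: factor_def pm_zero_sum_empty intro!: pm_zero_sum_union)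

text \<open>Converse of \<open>divisor_closed_submonoid_B_pm\<close>, with the union of the supports
  of the elements of \<open>S\<close> as \<open>A'\<close>.\<close>

lemma divisor_closed_submonoid_B_pm_cases:
  assumes "divisor_closed_submonoid S (B_pm G A)" "A \<subseteq> carrier G"
  obtains A' where "A' \<subseteq> A" "S = carrier (B_pm G A')"
proof
  have sub: "M \<in> S \<Longrightarrow> set_mset M \<subseteq> A \<and> pm_zero_sum G M"
    and plus: "M \<in> S \<Longrightarrow> N \<in> S \<Longrightarrow> M + N \<in> S"
    and zero: "{#} \<in> S" for M N
    using assms(1) unfolding divisor_closed_submonoid_def submonoid_def by auto
  \<comment> \<open>Divisibility in \<open>B_pm G A\<close> demands that the cofactor
    \<open>N\<close> be zero-sum as well.\<close>
  have div: "M \<in> S"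
    if "M + N \<in> S" "set_mset (M + N) \<subseteq> A" "pm_zero_sum G M" "pm_zero_sum G N" for M N
    using that assms(1) unfolding divisor_closed_submonoid_def by (auto simp: factor_def)
  let ?A' = "\<Union>(set_mset ` S)"
  show A': "?A' \<subseteq> A" using sub by auto
  \<comment> \<open>If \<open>M\<close> is \<open>x\<close> together with \<open>N\<close>, then
    \<open>M + M\<close> splits into \<open>{#x, x#}\<close> and \<open>N + N\<close>, both of them
    zero-sum by doubling.\<close>
  have square: "{#x, x#} \<in> S" if M: "M \<in> S" and x: "x \<in># M" for M x
  proof -
    obtain N where N: "M = add_mset x N" using x by (metis mset_add)
    have MA: "set_mset M \<subseteq> A" using sub M by blast
    show ?thesis
    proof (rule div[of _ "N + N"])
      show "{#x, x#} + (N + N) \<in> S" using plus[OF M M] by (simp add: N)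
      show "set_mset ({#x, x#} + (N + N)) \<subseteq> A" using MA N by auto
      show "pm_zero_sum G {#x, x#}"
        using pm_zero_sum_double[of "{#x#}"] MA N assms(2) by auto
      show "pm_zero_sum G (N + N)" using MA N assms(2) by (intro pm_zero_sum_double) auto
    qed
  qed
  have double: "M + M \<in> S" if "set_mset M \<subseteq> ?A'" for M
    using that
  proof (induction M)
    case empty
    then show ?case using zero by simp
  next
    case (add x M)
    then have "{#x, x#} \<in> S" "M + M \<in> S" using square by auto
    from plus[OF this] show ?case by simp
  qed
  show "S = carrier (B_pm G ?A')"
  proof (intro Set.set_eqI iffI)
    fix M assume "M \<in> S"
    then show "M \<in> carrier (B_pm G ?A')" using sub by auto
  next
    fix M assume M: "M \<in> carrier (B_pm G ?A')"
    then show "M \<in> S" using double A' by (intro div[of M M]) auto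
  qed
qed

text \<open>By the classification, divisor-closed submonoids may be replaced by subsets of
  \<open>A\<close>.\<close>

lemma Delta_star_B_pm:
  assumes "A \<subseteq> carrier G"
  shows "Delta_star (B_pm G A) =
    {LEAST d. d \<in> Delta (B_pm G A') | A'. A' \<subseteq> A \<and> Delta (B_pm G A') \<noteq> {}}"
    (is "_ = ?R")
proof (intro Set.set_eqI iffI)
  fix d assume "d \<in> Delta_star (B_pm G A)"
  then obtain S where S: "d = (LEAST d. d \<in> Delta (B_pm G A\<lparr>carrier := S\<rparr>))"
    "divisor_closed_submonoid S (B_pm G A)" "Delta (B_pm G A\<lparr>carrier := S\<rparr>) \<noteq> {}"
    unfolding Delta_star_def by blast
  obtain A' where "A' \<subseteq> A" "S = carrier (B_pm G A')"
    using divisor_closed_submonoid_B_pm_cases[OF S(2) assms] .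
  then show "d \<in> ?R"
    using S(1,3) by (auto simp: B_pm_carrier_update simp del: B_pm_simps)
next
  fix d assume "d \<in> ?R"
  then obtain A' where A': "d = (LEAST d. d \<in> Delta (B_pm G A'))" "A' \<subseteq> A"
    "Delta (B_pm G A') \<noteq> {}"
    by blast
  then show "d \<in> Delta_star (B_pm G A)"
    using divisor_closed_submonoid_B_pm[OF A'(2) assms]
    unfolding Delta_star_def
    by (intro CollectI exI[of _ "carrier (B_pm G A')"]) (simp add: B_pm_carrier_update del: B_pm_simps)
qed

lemma Delta_star_B_pm_pos:
  assumes "A \<subseteq> carrier G" "d \<in> Delta_star (B_pm G A)"
  shows "d > 0"
proof -
  obtain A' where "d = (LEAST d. d \<in> Delta (B_pm G A'))" "Delta (B_pm G A') \<noteq> {}"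
    using assms Delta_star_B_pm by auto
  then have "d \<in> Delta (B_pm G A')" by (metis LeastI all_not_in_conv)
  then show ?thesis unfolding Delta_def distances_def by auto
qed


subsection \<open>Torsion groups\<close>

text \<open>Generators are adjoined one at a time: in an abelian group the product of the finite
  subgroup \<open>H\<close> and the finite cyclic group generated by \<open>x\<close> is again a
  finite subgroup.\<close>

lemma torsion_finite_subgroup:
  assumes "torsion_group G" "finite F" "F \<subseteq> carrier G"
  obtains H where "subgroup H G" "finite H" "F \<subseteq> H"
proof -
  from assms(2,3) have "\<exists>H. subgroup H G \<and> finite H \<and> F \<subseteq> H"
  proof (induction F)
    case empty
    then show ?case using triv_subgroup by (intro exI[of _ "{\<one>}"]) auto
  next
    case (insert x F)
    then obtain H where H: "subgroup H G" "finite H" "F \<subseteq> H" by auto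
    have x: "x \<in> carrier G" using insert.prems by simp
    let ?K = "generate G {x}"
    have K: "subgroup ?K G" using x by (intro generate_is_subgroup) simp
    obtain n :: nat where "n > 0" "x [^] n = \<one>"
      using assms(1) x unfolding torsion_group_def by blast
    then have fin: "finite ?K"
      using finite_cyclic_subgroup[OF x] x by (auto simp: carrier_subgroup_generated)
    have "x \<in> H <#> ?K"
      using subgroup.one_closed[OF H(1)] generate.incl[of x "{x}" G] x
      unfolding set_mult_def by (force intro: bexI[of _ "\<one>"])
    moreover have "y \<in> H <#> ?K" if "y \<in> H" for y
      using that subgroup.mem_carrier[OF H(1)] generate.one[of G "{x}"]
      unfolding set_mult_def by (force intro: bexI[of _ "\<one>"])
    ultimately have "insert x F \<subseteq> H <#> ?K" using H(3) by auto
    moreover have "finite (H <#> ?K)" using H(2) fin unfolding set_mult_def by simp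
    ultimately show ?case using mult_subgroups[OF H(1) K] by blast
  qed
  then show thesis using that by blast
qed

lemma Delta_star_B_pm_torsion:
  assumes "torsion_group G"
  shows "Delta_star (B_pm G (carrier G)) =
    (\<Union>G' \<in> {G'. subgroup G' G \<and> finite G'}. Delta_star (B_pm G G'))"
proof (intro Set.set_eqI iffI)
  fix d assume "d \<in> Delta_star (B_pm G (carrier G))"
  then obtain A where A: "A \<subseteq> carrier G" "Delta (B_pm G A) \<noteq> {}"
    and d: "d = (LEAST d. d \<in> Delta (B_pm G A))"
    using Delta_star_B_pm by auto
  have "d \<in> Delta (B_pm G A)" using A(2) d by (metis LeastI all_not_in_conv)
  then obtain F where F: "finite F" "F \<subseteq> A" "d \<in> Delta (B_pm G F)"
    using Delta_B_pm_finite_support by blast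
  \<comment> \<open>Passing from \<open>A\<close> to \<open>F\<close> can only remove distances, and
    the minimum \<open>d\<close> survives.\<close>
  have "(LEAST d. d \<in> Delta (B_pm G F)) = d"
    using F Delta_B_pm_mono[OF F(2)] d by (intro Least_equality) (auto intro: Least_le)
  moreover obtain H where H: "subgroup H G" "finite H" "F \<subseteq> H"
    using torsion_finite_subgroup[OF assms F(1)] F(2) A(1) by blast
  ultimately have "d \<in> Delta_star (B_pm G H)"
    using Delta_star_B_pm[OF subgroup.subset[OF H(1)]] F(3) by blast
  then show "d \<in> (\<Union>G' \<in> {G'. subgroup G' G \<and> finite G'}. Delta_star (B_pm G G'))"
    using H by blast
next
  fix d assume "d \<in> (\<Union>G' \<in> {G'. subgroup G' G \<and> finite G'}. Delta_star (B_pm G G'))"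
  then obtain H where H: "subgroup H G" "d \<in> Delta_star (B_pm G H)" by blast
  have "H \<subseteq> carrier G" using subgroup.subset[OF H(1)] .
  then show "d \<in> Delta_star (B_pm G (carrier G))"
    using H(2) Delta_star_B_pm[of H] Delta_star_B_pm[of "carrier G"] by fast
qed


subsection \<open>Two powers of an element of infinite order\<close>

text \<open>The bound \<open>n \<ge> 2\<close> keeps \<open>h\<close> apart from \<open>g\<close>
  and makes the intended distance \<open>n - 1\<close> positive.\<close>

context
  fixes g :: 'a and n :: nat and h :: 'a
  assumes g: "g \<in> carrier G"
    and inf: "\<And>k::nat. k > 0 \<Longrightarrow> g [^] k \<noteq> \<one>"
    and n: "n \<ge> 2"
  defines "h \<equiv> g [^] n"
begin

lemma h_closed: "h \<in> carrier G"
  using g by (simp add: h_def)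

lemma int_pow_eq_one_imp:
  assumes "g [^] (k::int) = \<one>"
  shows "k = 0"
proof (cases "k \<ge> 0")
  case True
  then have "g [^] nat k = \<one>" using assms int_pow_int[of G g "nat k"] by simp
  then show ?thesis using inf[of "nat k"] True by force
next
  case False
  then have "g [^] (- k) = \<one>" using assms g by (simp add: int_pow_neg)
  then have "g [^] nat (- k) = \<one>" using False int_pow_int[of G g "nat (- k)"] by simp
  then show ?thesis using inf[of "nat (- k)"] False by force
qed

lemma g_neq_h: "g \<noteq> h"
proof
  assume "g = h"
  then have "g [^] (1::int) = g [^] int n" using g by (simp add: h_def int_pow_int)
  then have "g [^] (1 - int n) = \<one>" using g by (simp add: int_pow_diff)
  then show False using int_pow_eq_one_imp n by force
qed

section \<open>Multiplicities in zero-sum sequences over \<open>{g, h}\<close>\<close>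

text \<open>Here \<open>s\<close> and \<open>t\<close> are the sums of the signs given to the copies
  of \<open>g\<close> and of \<open>h\<close>. A sum of \<open>k\<close> signs has absolute value at
  most \<open>k\<close> and the parity of \<open>k\<close>.\<close>

lemma signed_prod_exponents:
  assumes "signed_prod G M y" "set_mset M \<subseteq> {g, h}"
  shows "\<exists>s t :: int. y = g [^] (s + int n * t) \<and>
    \<bar>s\<bar> \<le> int (count M g) \<and> \<bar>t\<bar> \<le> int (count M h) \<and>
    even (s - int (count M g)) \<and> even (t - int (count M h))"
proof -
  \<comment> \<open>Both sign sums are updated at once: \<open>e\<close> and \<open>f\<close> are
    the increments, \<open>k\<close> and \<open>l\<close> the added multiplicities. It is applied
    with one pair zero and the other increment 1 or -1.\<close>
  have step: "\<exists>s' t' :: int. g [^] (s + int n * t) \<otimes> g [^] (e + int n * f) = g [^] (s' + int n * t') \<and>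
      \<bar>s'\<bar> \<le> int (a + k) \<and> \<bar>t'\<bar> \<le> int (b + l) \<and> even (s' - int (a + k)) \<and> even (t' - int (b + l))"
    if "\<bar>s\<bar> \<le> int a" "\<bar>t\<bar> \<le> int b" "even (s - int a)" "even (t - int b)"
      "\<bar>e\<bar> = int k" "\<bar>f\<bar> = int l" for s t e f :: int and a b k l :: nat
  proof (intro exI conjI)
    have "s + e + int n * (t + f) = s + int n * t + (e + int n * f)" by (simp add: algebra_simps)
    then show "g [^] (s + int n * t) \<otimes> g [^] (e + int n * f) = g [^] (s + e + int n * (t + f))"
      using g by (simp only: int_pow_mult)
    show "\<bar>s + e\<bar> \<le> int (a + k)" "\<bar>t + f\<bar> \<le> int (b + l)" using that by linarith+
    have "even (e - int k)" "even (f - int l)" using that(5,6) by presburger+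
    then show "even (s + e - int (a + k))" "even (t + f - int (b + l))"
      using that(3,4) by presburger+
  qed
  show ?thesis
    using assms
  proof induction
    case empty
    then show ?case by (intro exI[of _ 0]) simp
  next
    case (pos M y x)
    then obtain s t :: int where st: "y = g [^] (s + int n * t)"
      "\<bar>s\<bar> \<le> int (count M g)" "\<bar>t\<bar> \<le> int (count M h)"
      "even (s - int (count M g))" "even (t - int (count M h))"
      by auto
    consider "x = g" | "x = h" using pos.prems by auto
    then show ?case
    proof cases
      case 1
      then have "x = g [^] (1 + int n * 0)" using g by (simp add: int_pow_neg)
      then show ?thesis using step[OF st(2-5), of "1" 1 0 0] g_neq_h 1 st(1) by simp
    next
      case 2
      then have "x = g [^] (0 + int n * 1)"
        using g by (simp add: h_def int_pow_int int_pow_neg)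
      then show ?thesis using step[OF st(2-5), of 0 0 "1" 1] g_neq_h 2 st(1) by simp
    qed
  next
    case (neg M y x)
    then obtain s t :: int where st: "y = g [^] (s + int n * t)"
      "\<bar>s\<bar> \<le> int (count M g)" "\<bar>t\<bar> \<le> int (count M h)"
      "even (s - int (count M g))" "even (t - int (count M h))"
      by auto
    consider "x = g" | "x = h" using neg.prems by auto
    then show ?case
    proof cases
      case 1
      then have "inv x = g [^] (- 1 + int n * 0)" using g by (simp add: int_pow_neg)
      then show ?thesis using step[OF st(2-5), of "- 1" 1 0 0] g_neq_h 1 st(1) by simp
    next
      case 2
      then have "inv x = g [^] (0 + int n * (- 1))"
        using g by (simp add: h_def int_pow_int int_pow_neg)
      then show ?thesis using step[OF st(2-5), of 0 0 "- 1" 1] g_neq_h 2 st(1) by simp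
    qed
  qed
qed

text \<open>As \<open>g\<close> has infinite order, the sign sums satisfy \<open>s = - n t\<close>.
  Reducing this modulo 2 gives the parity claim; an odd number of copies of \<open>h\<close> makes
  \<open>t\<close> odd, hence nonzero, so at least \<open>n\<close> copies of \<open>g\<close> are
  needed for balance.\<close>

lemma pm_zero_sum_pair_imp:
  assumes "set_mset M \<subseteq> {g, h}" "pm_zero_sum G M"
  shows "even (count M g + n * count M h)" "odd (count M h) \<Longrightarrow> n \<le> count M g"
proof -
  have "signed_prod G M \<one>"
    using assms g h_closed by (subst pm_zero_sum_iff_signed_prod[symmetric]) auto
  from signed_prod_exponents[OF this assms(1)] obtain s t :: int where
    "\<one> = g [^] (s + int n * t)"
    and st: "\<bar>s\<bar> \<le> int (count M g)" "\<bar>t\<bar> \<le> int (count M h)"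
      "even (s - int (count M g))" "even (t - int (count M h))"
    by auto
  then have s: "s = - (int n * t)" using int_pow_eq_one_imp[of "s + int n * t"] by simp
  have "even (int (count M g) + int n * int (count M h))"
    using st(3,4) unfolding s by auto
  then show "even (count M g + n * count M h)"
    by (metis even_of_nat of_nat_add of_nat_mult)
  show "n \<le> count M g" if "odd (count M h)"
  proof -
    have "t \<noteq> 0" using st(4) that by auto
    then have "int n * 1 \<le> int n * \<bar>t\<bar>" by (intro mult_left_mono) auto
    also have "\<dots> = \<bar>s\<bar>" by (simp add: s abs_mult)
    finally show ?thesis using st(1) by simp
  qed
qed

definition mixed_atom where "mixed_atom = add_mset h (replicate_mset n g)"

lemma mixed_atom_zero_sum: "pm_zero_sum G mixed_atom"
proof -
  \<comment> \<open>All copies of \<open>g\<close> are taken with sign 1 and the single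
    \<open>h\<close> with sign -1.\<close>
  have "signed_prod G mixed_atom (g [^] n \<otimes> inv h)"
    unfolding mixed_atom_def using g h_closed by (intro signed_prod.neg signed_prod_replicate)
  then have "signed_prod G mixed_atom \<one>" using h_closed by (simp add: h_def)
  then show ?thesis
    using g h_closed by (subst pm_zero_sum_iff_signed_prod) (auto simp: mixed_atom_def)
qed

lemma count_mixed_atom [simp]: "count mixed_atom g = n" "count mixed_atom h = 1"
  using g_neq_h by (auto simp: mixed_atom_def)

lemma multiset_pair_eqI:
  assumes "set_mset M \<subseteq> {g, h}" "set_mset N \<subseteq> {g, h}" "count M g = count N g" "count M h = count N h"
  shows "M = N"
proof (rule multiset_eqI)
  fix x
  show "count M x = count N x"
  proof (cases "x \<in> {g, h}")
    case False
    then have "count M x = 0" "count N x = 0" using assms(1,2) by (auto simp: count_eq_zero_iff)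
    then show ?thesis by simp
  qed (use assms in auto)
qed

section \<open>The atoms over \<open>{g, h}\<close>\<close>

text \<open>Halving both multiplicities writes \<open>M\<close> as a double, which is
  zero-sum.\<close>

lemma even_imp_pm_zero_sum:
  assumes "set_mset M \<subseteq> {g, h}" "even (count M g)" "even (count M h)"
  shows "pm_zero_sum G M"
proof -
  define N where "N = replicate_mset (count M g div 2) g + replicate_mset (count M h div 2) h"
  have "set_mset N \<subseteq> {g, h}" by (auto simp: N_def)
  then have "M = N + N"
    using assms g_neq_h by (intro multiset_pair_eqI) (auto simp: N_def)
  then show ?thesis
    using pm_zero_sum_double[of N] \<open>set_mset N \<subseteq> {g, h}\<close> g h_closed by auto
qed

text \<open>One of the three sequences is always contained in \<open>M\<close> with a complement of
  even multiplicities. That complement is zero-sum, so it must be empty when \<open>M\<close> is an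
  atom.\<close>

lemma atom_pair_cases:
  assumes "atom (B_pm G {g, h}) M"
  shows "M = {#g, g#} \<or> M = {#h, h#} \<or> M = mixed_atom"
proof -
  have M: "set_mset M \<subseteq> {g, h}" "pm_zero_sum G M" "M \<noteq> {#}"
    and irr: "\<And>N K. M = N + K \<Longrightarrow> pm_zero_sum G N \<Longrightarrow> pm_zero_sum G K \<Longrightarrow> N = {#} \<or> K = {#}"
    using assms unfolding atom_def by auto
  note imp = pm_zero_sum_pair_imp[OF M(1,2)]
  have split: "M = N"
    if N: "N \<subseteq># M" "N \<noteq> {#}" "pm_zero_sum G N"
      and ev: "even (count M g - count N g)" "even (count M h - count N h)" for N
  proof -
    have "set_mset (M - N) \<subseteq> {g, h}" using M(1) by (meson in_diffD subset_iff)
    then have "pm_zero_sum G (M - N)" using ev by (intro even_imp_pm_zero_sum) auto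
    then have "M - N = {#}" using irr[of N "M - N"] N by auto
    then show ?thesis using N(1) by (metis subset_mset.add_diff_inverse add.right_neutral)
  qed
  have sq: "pm_zero_sum G {#x, x#}" if "x \<in> {g, h}" for x
    using pm_zero_sum_double[of "{#x#}"] that g h_closed by auto
  show ?thesis
  proof (cases "even (count M h)")
    case False
    \<comment> \<open>With \<open>count M h\<close> odd, the parity condition says that
      \<open>count M g\<close> and \<open>n\<close> are congruent modulo 2.\<close>
    then have ev: "even (count M g - n)" "n \<le> count M g" using imp by auto
    have "mixed_atom \<subseteq># M"
    proof (rule mset_subset_eqI)
      fix x
      show "count mixed_atom x \<le> count M x"
        using False ev g_neq_h by (cases "count M h = 0") (auto simp: mixed_atom_def Suc_le_eq)
    qed
    moreover have "mixed_atom \<noteq> {#}" by (simp add: mixed_atom_def)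
    ultimately have "M = mixed_atom" using False ev mixed_atom_zero_sum by (intro split) auto
    then show ?thesis by simp
  next
    case True
    \<comment> \<open>Now both multiplicities are even, so any term of \<open>M\<close> occurs at
      least twice and its square can be split off.\<close>
    then have ev: "even (count M g)" using imp by auto
    have two: "{#x, x#} \<subseteq># M" if "x \<in># M" "even (count M x)" for x
    proof (rule mset_subset_eqI)
      fix y
      have "count M x \<noteq> 0" "count M x \<noteq> 1" using that by auto
      then have "2 \<le> count M x" by linarith
      then show "count {#x, x#} y \<le> count M y" by auto
    qed
    obtain x where x: "x \<in># M" using M(3) by blast
    then consider "x = g" | "x = h" using M(1) by auto
    then have "M = {#x, x#}"
      using x True ev two[of x] sq[of x] g_neq_h by cases (intro split; simp)+
    then show ?thesis using x M(1) by auto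
  qed
qed

lemma atom_square:
  assumes "x \<in> {g, h}"
  shows "atom (B_pm G {g, h}) {#x, x#}"
proof -
  \<comment> \<open>For \<open>x = g\<close> the parity condition fails; for \<open>x = h\<close>
    the required \<open>n\<close> copies of \<open>g\<close> are missing.\<close>
  have single: "\<not> pm_zero_sum G {#x#}"
    using pm_zero_sum_pair_imp[of "{#x#}"] assms n g_neq_h by auto
  have False if "{#x, x#} = N + K" "N \<noteq> {#}" "K \<noteq> {#}" "pm_zero_sum G N" for N K
  proof -
    have "size N + size K = 2"
      using that(1) by (metis size_union size_add_mset size_empty numeral_2_eq_2)
    moreover have "size N \<noteq> 0" "size K \<noteq> 0" using that by auto
    ultimately have "size N = 1" by linarith
    then obtain y where "N = {#y#}" by (metis size_1_singleton_mset)
    moreover have "set_mset N \<subseteq> {x}"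
      using that(1)
      by (metis Un_upper1 set_mset_union set_mset_add_mset_insert set_mset_empty insert_absorb2)
    ultimately show False using that(4) single by auto
  qed
  then show ?thesis
    using assms pm_zero_sum_double[of "{#x#}"] g h_closed unfolding atom_def by auto
qed

text \<open>In a decomposition, the factor holding the only \<open>h\<close> must also take all
  \<open>n\<close> copies of \<open>g\<close>, so nothing is left for the other.\<close>

lemma atom_mixed_atom: "atom (B_pm G {g, h}) mixed_atom"
proof -
  have aux: "K = {#}"
    if "mixed_atom = N + K" "set_mset N \<subseteq> {g, h}" "set_mset K \<subseteq> {g, h}" "pm_zero_sum G N" "count N h = 1" for N K
  proof -
    have "n \<le> count N g" using pm_zero_sum_pair_imp(2) that by simp
    moreover have "count N g + count K g = n" "count N h + count K h = 1"
      using that(1) count_mixed_atom by (metis count_union)+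
    ultimately have "count K g = 0" "count K h = 0" using that(5) by auto
    then show ?thesis using that(3) by (intro multiset_pair_eqI) auto
  qed
  have False if "mixed_atom = N + K" "set_mset N \<subseteq> {g, h}" "set_mset K \<subseteq> {g, h}"
    "pm_zero_sum G N" "pm_zero_sum G K" "N \<noteq> {#}" "K \<noteq> {#}" for N K
  proof -
    have "count N h + count K h = 1" using that(1) count_mixed_atom by (metis count_union)
    then have "count N h = 1 \<or> count K h = 1" by auto
    then show False using aux[of N K] aux[of K N] that by (auto simp: add.commute)
  qed
  moreover have "set_mset mixed_atom \<subseteq> {g, h}" "mixed_atom \<noteq> {#}" by (auto simp: mixed_atom_def)
  ultimately show ?thesis using mixed_atom_zero_sum unfolding atom_def by auto
qed

text \<open>Here \<open>z\<close> is the number of factors equal to \<open>mixed_atom\<close>.\<close>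

lemma length_pair:
  assumes "\<forall>u\<in>set us. atom (B_pm G {g, h}) u"
  shows "\<exists>z. 2 * length us + (n - 1) * z = size (sum_list us) \<and>
    (even z \<longleftrightarrow> even (count (sum_list us) h))"
  using assms
proof (induction us)
  case Nil
  then show ?case by (intro exI[of _ 0]) simp
next
  case (Cons u us)
  then obtain z where z: "2 * length us + (n - 1) * z = size (sum_list us)"
    "even z \<longleftrightarrow> even (count (sum_list us) h)"
    by auto
  consider "u = {#g, g#}" | "u = {#h, h#}" | "u = mixed_atom" using atom_pair_cases Cons.prems by auto
  then show ?case
  proof cases
    case 1
    then have "size u = 2" "even (count u h)" using g_neq_h by auto
    then have "2 * length (u # us) + (n - 1) * z = size (sum_list (u # us))"
      "even z \<longleftrightarrow> even (count (sum_list (u # us)) h)"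
      using z by simp_all
    then show ?thesis by blast
  next
    case 2
    then have "size u = 2" "even (count u h)" using g_neq_h by auto
    then have "2 * length (u # us) + (n - 1) * z = size (sum_list (u # us))"
      "even z \<longleftrightarrow> even (count (sum_list (u # us)) h)"
      using z by simp_all
    then show ?thesis by blast
  next
    case 3
    \<comment> \<open>Squares have size 2, so each mixed atom exceeds them by \<open>n - 1\<close>;
      it is also the only atom with an odd number of copies of \<open>h\<close>.\<close>
    have "size mixed_atom = 2 + (n - 1)" using n by (simp add: mixed_atom_def)
    then have "size u = 2 + (n - 1)" "odd (count u h)" using 3 by simp_all
    then have "2 * length (u # us) + (n - 1) * Suc z = size (sum_list (u # us))"
      "even (Suc z) \<longleftrightarrow> even (count (sum_list (u # us)) h)"
      using z by simp_all
    then show ?thesis by blast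
  qed
qed

section \<open>Lengths and distances over \<open>{g, h}\<close>\<close>

text \<open>Two factorizations of \<open>M\<close> contain numbers of mixed atoms of equal parity,
  which allows the factor 2 in the length formula to be cancelled. If \<open>l \<le> k\<close>,
  truncated subtraction makes the claim trivial.\<close>

lemma dvd_length_diff:
  assumes "k \<in> lengths (B_pm G {g, h}) M" "l \<in> lengths (B_pm G {g, h}) M"
  shows "n - 1 dvd l - k"
proof -
  obtain z where z: "2 * k + (n - 1) * z = size M" "even z \<longleftrightarrow> even (count M h)"
    using assms(1) length_pair unfolding lengths_B_pm by blast
  obtain y where y: "2 * l + (n - 1) * y = size M" "even y \<longleftrightarrow> even (count M h)"
    using assms(2) length_pair unfolding lengths_B_pm by blast
  have "even (z - y)" using z(2) y(2) by auto
  then obtain w where w: "z - y = 2 * w" by blast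
  have "2 * (l - k) = (n - 1) * z - (n - 1) * y" using z(1) y(1) by linarith
  also have "\<dots> = (n - 1) * (2 * w)" by (simp add: w flip: diff_mult_distrib2)
  finally have "l - k = (n - 1) * w" by simp
  then show ?thesis by simp
qed

lemma Delta_pair_ge:
  assumes "d \<in> Delta (B_pm G {g, h})"
  shows "n - 1 \<le> d"
proof -
  obtain M k l where "k \<in> lengths (B_pm G {g, h}) M" "l \<in> lengths (B_pm G {g, h}) M"
    "k < l" "d = l - k"
    using assms unfolding Delta_def distances_def by blast
  then show ?thesis using dvd_length_diff[of k M l] by (auto intro: dvd_imp_le)
qed

text \<open>The witness is the square of \<open>mixed_atom\<close>: its lengths 2 and
  \<open>n + 1\<close> come from the two sides of the relation between the atoms.\<close>

lemma Delta_pair_mem: "n - 1 \<in> Delta (B_pm G {g, h})"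
proof -
  let ?L = "lengths (B_pm G {g, h}) (mixed_atom + mixed_atom)"
  have mixed_atom: "set_mset mixed_atom \<subseteq> {g, h}" by (auto simp: mixed_atom_def)
  have two: "2 \<in> ?L"
    unfolding lengths_B_pm using atom_mixed_atom by (auto intro!: exI[of _ "[mixed_atom, mixed_atom]"])
  let ?us = "{#h, h#} # replicate n {#g, g#}"
  have "sum_list ?us = mixed_atom + mixed_atom"
  proof (rule multiset_pair_eqI)
    show "set_mset (sum_list ?us) \<subseteq> {g, h}" by auto
    have "count (sum_list (replicate n {#g, g#})) x = n * count {#g, g#} x" for x
      by (induction n) auto
    then show "count (sum_list ?us) g = count (mixed_atom + mixed_atom) g" "count (sum_list ?us) h = count (mixed_atom + mixed_atom) h"
      using g_neq_h by auto
  qed (use mixed_atom in auto)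
  then have Suc: "Suc n \<in> ?L"
    unfolding lengths_B_pm using atom_square by (auto intro!: exI[of _ ?us])
  \<comment> \<open>A length above 2 exceeds it by a positive multiple of \<open>n - 1\<close>, so
    it is at least \<open>n + 1\<close>.\<close>
  have "?L \<inter> {2<..<Suc n} = {}"
  proof (rule ccontr)
    assume "?L \<inter> {2<..<Suc n} \<noteq> {}"
    then obtain k where k: "k \<in> ?L" "2 < k" "k < Suc n" by auto
    then have "n - 1 \<le> k - 2" using dvd_length_diff[OF two k(1)] by (auto intro: dvd_imp_le)
    then show False using k by auto
  qed
  then have "n - 1 \<in> distances ?L"
    using two Suc n unfolding distances_def by (intro CollectI exI[of _ 2] exI[of _ "Suc n"]) auto
  moreover have "mixed_atom + mixed_atom \<in> carrier (B_pm G {g, h})"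
    using mixed_atom g h_closed pm_zero_sum_double[of mixed_atom] by auto
  ultimately show ?thesis unfolding Delta_def by blast
qed

lemma Delta_star_pair: "n - 1 \<in> Delta_star (B_pm G (carrier G))"
proof -
  have "(LEAST d. d \<in> Delta (B_pm G {g, h})) = n - 1"
    using Delta_pair_mem Delta_pair_ge by (intro Least_equality)
  moreover have "{g, h} \<subseteq> carrier G" "Delta (B_pm G {g, h}) \<noteq> {}"
    using g h_closed Delta_pair_mem by auto
  ultimately show ?thesis
    unfolding Delta_star_B_pm[OF subset_refl] by (intro CollectI exI[of _ "{g, h}"]) simp
qed

end

section \<open>Groups that are not torsion\<close>

lemma Delta_star_B_pm_not_torsion:
  assumes "\<not> torsion_group G"
  shows "Delta_star (B_pm G (carrier G)) = {n. n > 0}"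
proof -
  obtain g where g: "g \<in> carrier G" "\<And>k::nat. k > 0 \<Longrightarrow> g [^] k \<noteq> \<one>"
    using assms unfolding torsion_group_def by blast
  \<comment> \<open>The pair \<open>g\<close>, \<open>h\<close> with exponent \<open>Suc d\<close>
    realises \<open>d\<close>; positivity of \<open>d\<close> gives
    \<open>Suc d \<ge> 2\<close>.\<close>
  have "d \<in> Delta_star (B_pm G (carrier G))" if "d > 0" for d
    using Delta_star_pair[OF g, of "Suc d"] that by simp
  then show ?thesis using Delta_star_B_pm_pos[OF subset_refl] by blast
qed

end

theorem theorem4p19:
  fixes G :: "('a, 'b) monoid_scheme"
  assumes "comm_group G"
  shows "(\<not> torsion_group G \<longrightarrow> Delta_star (B_pm G (carrier G)) = {n. n > 0}) \<and>
         (torsion_group G \<longrightarrow> Delta_star (B_pm G (carrier G)) =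
            (\<Union>G' \<in> {G'. subgroup G' G \<and> finite G'}. Delta_star (B_pm G G')))"
  using comm_group.Delta_star_B_pm_not_torsion[OF assms]
    comm_group.Delta_star_B_pm_torsion[OF assms]
  by blast

end
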